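(* Let $w$ be a word and let $(a_i)$ be a representing sequence. The following are equivalent: (1) $w$ is the representation word of $(a_i)$; (2) $w$ is infinite, and for each nonnegative integer $n$, \[ w[n]=\begin{cases} n & n<a_1,\\ a_1 & n=a_{j+1}-1\text{ and }j\geq1,\\ w[n-a_j] & \text{otherwise},\end{cases} \] where $j$ is the index of $n$, i.e. the integer with $a_j\le n<a_{j+1}$.
   Context: A representing sequence is a strictly increasing sequence $(a_i)_{i\ge0}$ of positive integers with $a_0=1$. For $n\ge1$ with $a_j\le n<a_{j+1}$, the $(a_i)$-representation of $n$ is the digit string $d_j\cdots d_0$ with $n=\sum d_ia_i$ and $\sum d_i$ minimal (greedy: $d_j=\lfloor n/a_j\rfloor$, then recursively $n\bmod a_j$); the representation of $0$ is the digit $0$. $n\ge0$ is $2$-volatile if the representation of $n+1$ ends in at least two zeros. The representation word of $(a_i)$ is the infinite word $w$ over $\{0,\dots,a_1\}$ (indexed from $0$) with $w[n]=a_1$ if $n$ is $2$-volatile and otherwise $w[n]$ equals the last digit of the representation of $n$. *)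

theory Defs
  imports Main "HOL-Library.Sublist"
begin

datatype 'a word = is_finite: FinWord "'a list" | is_infinite: InfWord "nat \<Rightarrow> 'a"

fun letter :: "'a word \<Rightarrow> nat \<Rightarrow> 'a" where
  "letter (FinWord xs) n = xs ! n"
| "letter (InfWord f) n = f n"

definition representing_sequence :: "(nat \<Rightarrow> nat) \<Rightarrow> bool" where
  "representing_sequence a \<longleftrightarrow> strict_mono a \<and> (\<forall>i. a i > 0) \<and> a 0 = 1"

text \<open>Only meaningful for \<open>n \<ge> 1\<close>; no such \<open>j\<close> exists for \<open>n = 0\<close>.\<close>

definition index :: "(nat \<Rightarrow> nat) \<Rightarrow> nat \<Rightarrow> nat" where
  "index a n = (THE j. a j \<le> n \<and> n < a (Suc j))"

text \<open>
  Digit strings are lists with the most significant digit first, as they are written.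
  The string \<open>greedy_digits a j n\<close> is \<open>d\<^sub>j \<dots> d\<^sub>0\<close>; it always has length \<open>j + 1\<close>, so remainders
  are padded with zeros on the left.
\<close>

fun greedy_digits :: "(nat \<Rightarrow> nat) \<Rightarrow> nat \<Rightarrow> nat \<Rightarrow> nat list" where
  "greedy_digits a 0 n = [n div a 0]"
| "greedy_digits a (Suc j) n = (n div a (Suc j)) # greedy_digits a j (n mod a (Suc j))"

text \<open>
  The representation is the greedy one. For some sequences it is not of minimal digit sum: with
  \<open>1, 3, 4, \<dots>\<close> it writes \<open>6 = 4 + 1 + 1\<close>, not \<open>3 + 3\<close>.
\<close>

definition representation :: "(nat \<Rightarrow> nat) \<Rightarrow> nat \<Rightarrow> nat list" where
  "representation a n = (if n = 0 then [0] else greedy_digits a (index a n) n)"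

definition two_volatile :: "(nat \<Rightarrow> nat) \<Rightarrow> nat \<Rightarrow> bool" where
  "two_volatile a n \<longleftrightarrow> suffix [0, 0] (representation a (n + 1))"

definition representation_word :: "(nat \<Rightarrow> nat) \<Rightarrow> nat word" where
  "representation_word a =
     InfWord (\<lambda>n. if two_volatile a n then a 1 else last (representation a n))"

lemma index_unique:
  assumes "representing_sequence a" and "n \<ge> 1"
  shows "\<exists>!j. a j \<le> n \<and> n < a (Suc j)"
proof -
  have m: "strict_mono a" and a0: "a 0 = 1"
    using assms(1) by (auto simp: representing_sequence_def)
  have "\<exists>k. n < a k"
    using strict_mono_imp_increasing[OF m, of "Suc n"] by (meson Suc_le_lessD)
  then have k: "n < a (LEAST k. n < a k)" by (rule LeastI_ex)
  then obtain j where j: "(LEAST k. n < a k) = Suc j"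
    using a0 assms(2) by (metis not0_implies_Suc not_less)
  then have "a j \<le> n" using not_less_Least[of j "\<lambda>k. n < a k"] by simp
  with k j have ex: "a j \<le> n \<and> n < a (Suc j)" by simp
  have "i = l" if "a i \<le> n \<and> n < a (Suc i)" "a l \<le> n \<and> n < a (Suc l)" for i l
  proof -
    have "a i < a (Suc l)" "a l < a (Suc i)" using that by auto
    then show ?thesis using m by (simp add: strict_mono_less)
  qed
  with ex show ?thesis by blast
qed

end

theory Submission imports Defs begin

text \<open>
  Let \<open>greedy_rem a k j n\<close> be the remainder of \<open>n\<close> after greedily removing multiples of
  \<open>a\<^sub>j, \<dots>, a\<^sub>k\<close>. The last digit of \<open>n\<close> is this remainder for \<open>k = 1\<close>, and a positive \<open>n\<close> ends in
  two zeros iff it vanishes for \<open>k = 2\<close>. Unlike digit strings, remainders do not depend on how many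
  leading zeros are used, and for \<open>a\<^sub>j \<le> n\<close> they do not change when \<open>n\<close> is replaced by
  \<open>n - a\<^sub>j\<close>. Hence the representation word satisfies the recursion, which in turn determines a word
  by strong induction.
\<close>

primrec greedy_rem :: "(nat \<Rightarrow> nat) \<Rightarrow> nat \<Rightarrow> nat \<Rightarrow> nat \<Rightarrow> nat" where
  "greedy_rem a k 0 n = n"
| "greedy_rem a k (Suc j) n = greedy_rem a k j (if k \<le> Suc j then n mod a (Suc j) else n)"

lemma greedy_rem_zero [simp]: "greedy_rem a k j 0 = 0"
  by (induction j) auto

lemma greedy_rem_less: "j < k \<Longrightarrow> greedy_rem a k j n = n"
  by (induction j) auto

text \<open>\<open>n\<close> and \<open>n - a j\<close> are congruent modulo \<open>a j\<close>, and
  the first removal keeps only that residue. With \<open>j < k\<close> nothing is removed and the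
  claim would fail.\<close>

lemma greedy_rem_diff:
  assumes "a j \<le> n" and "k \<le> j" and "0 < k"
  shows "greedy_rem a k j n = greedy_rem a k j (n - a j)"
  using assms by (cases j) (auto simp: le_mod_geq)

text \<open>Every term above \<open>a i\<close> exceeds \<open>n\<close>, so reducing modulo it
  changes nothing. Thus two numbers of different index can be compared at one common level
  \<open>j\<close>.\<close>

lemma greedy_rem_pad:
  assumes "strict_mono a" and "n < a (Suc i)" and "i \<le> j"
  shows "greedy_rem a k j n = greedy_rem a k i n"
  using assms(3)
proof (induction j rule: dec_induct)
  case (step m)
  have "a (Suc i) \<le> a (Suc m)"
    using step.hyps assms(1) by (simp add: strict_mono_less_eq)
  then show ?case using step assms(2) by simp
qed simp

lemma greedy_digits_neq_Nil [simp]: "greedy_digits a j n \<noteq> []"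
  by (cases j) auto

lemma length_greedy_digits [simp]: "length (greedy_digits a j n) = Suc j"
  by (induction j arbitrary: n) auto

lemma last_greedy_digits:
  assumes "a 0 = 1"
  shows "last (greedy_digits a j n) = greedy_rem a 1 j n"
  using assms by (induction j arbitrary: n) auto

text \<open>Dropping leading digits leaves a two-digit string, whose digits both vanish only for the
  number 0. \<open>Suc j\<close> guarantees that there are two digits: at level 0 the number 0 has
  remainder 0 but only one digit.\<close>

lemma suffix_zeros_greedy_digits:
  assumes "a 0 = 1" and "0 < a 1"
  shows "suffix [0, 0] (greedy_digits a (Suc j) n) \<longleftrightarrow> greedy_rem a 2 (Suc j) n = 0"
proof (induction j arbitrary: n)
  case 0
  have "n = 0" if "n div a 1 = 0" "n mod a 1 = 0"
    using that div_mult_mod_eq[of n "a 1"] by simp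
  then show ?case using assms by (auto simp: suffix_Cons)
next
  case (Suc j)
  \<comment> \<open>Since the string has at least three digits, \<open>[0, 0]\<close> can only be a
    suffix of its tail.\<close>
  have "[0, 0] \<noteq> x # greedy_digits a (Suc j) m" for x m
  proof
    assume "[0, 0] = x # greedy_digits a (Suc j) m"
    then have "length [0, 0 :: nat] = length (x # greedy_digits a (Suc j) m)" by (rule arg_cong)
    then show False by (simp del: greedy_digits.simps)
  qed
  then have "suffix [0, 0] (greedy_digits a (Suc (Suc j)) n)
      \<longleftrightarrow> suffix [0, 0] (greedy_digits a (Suc j) (n mod a (Suc (Suc j))))"
    unfolding greedy_digits.simps(2)[of a "Suc j"] suffix_Cons by blast
  then show ?case using Suc.IH by simp
qed

context
  fixes a :: "nat \<Rightarrow> nat"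
  assumes rep: "representing_sequence a"
begin

lemma mono: "strict_mono a" and a_0: "a 0 = 1" and a_pos: "0 < a i"
  using rep by (auto simp: representing_sequence_def)

lemma index_bounds:
  assumes "1 \<le> n"
  shows "a (index a n) \<le> n" and "n < a (Suc (index a n))"
  using theI'[OF index_unique[OF rep assms]] by (auto simp: index_def)

lemma index_le:
  assumes "1 \<le> n" and "n < a (Suc j)"
  shows "index a n \<le> j"
proof -
  have "a (index a n) < a (Suc j)" using index_bounds(1)[OF assms(1)] assms(2) by simp
  then show ?thesis using mono by (simp add: strict_mono_less)
qed

lemma last_representation:
  assumes "n < a (Suc j)"
  shows "last (representation a n) = greedy_rem a 1 j n"
proof (cases "n = 0")
  case False
  then have "1 \<le> n" by simp
  then show ?thesis
    using greedy_rem_pad[OF mono index_bounds(2) index_le] assms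
    by (simp add: representation_def last_greedy_digits a_0)
qed (simp add: representation_def)

lemma two_volatile_iff:
  assumes "n + 1 < a (Suc j)"
  shows "two_volatile a n \<longleftrightarrow> greedy_rem a 2 j (n + 1) = 0"
proof -
  have "greedy_rem a 2 j (n + 1) = greedy_rem a 2 (index a (n + 1)) (n + 1)"
    using assms by (intro greedy_rem_pad mono index_bounds index_le) auto
  moreover have "two_volatile a n \<longleftrightarrow> greedy_rem a 2 (index a (n + 1)) (n + 1) = 0"
  proof (cases "index a (n + 1)")
    \<comment> \<open>A single digit never ends in two zeros, and here the remainder is
      \<open>n + 1\<close> itself, which is positive.\<close>
    case 0
    then show ?thesis by (auto simp: two_volatile_def representation_def suffix_Cons)
  next
    case (Suc i)
    then show ?thesis
      using suffix_zeros_greedy_digits[OF a_0 a_pos[of 1]]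
      by (simp add: two_volatile_def representation_def del: greedy_digits.simps greedy_rem.simps)
  qed
  ultimately show ?thesis by simp
qed

lemma letter_representation_word:
  "letter (representation_word a) n =
     (if n < a 1 then n
      else if n = a (index a n + 1) - 1 \<and> index a n \<ge> 1 then a 1
      else letter (representation_word a) (n - a (index a n)))"
proof (cases "n < a 1")
  case True
  \<comment> \<open>\<open>n + 1\<close> may equal \<open>a 1\<close>, so volatility is tested at
    level 1 rather than 0; for \<open>k = 2\<close> that level still removes nothing.\<close>
  moreover have "a 1 < a (Suc 1)" using mono by (simp add: strict_mono_less)
  ultimately have "n + 1 < a (Suc 1)" by linarith
  then have "\<not> two_volatile a n" by (simp add: two_volatile_iff greedy_rem_less)
  then show ?thesis
    using True last_representation[of n 0] by (simp add: representation_word_def)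
next
  case False
  define j where "j = index a n"
  have n: "1 \<le> n" using False a_pos[of 1] by linarith
  have bounds: "a j \<le> n" "n < a (Suc j)" using index_bounds[OF n] by (simp_all add: j_def)
  have j: "1 \<le> j" using bounds False by (cases j) auto
  show ?thesis
  proof (cases "n + 1 = a (Suc j)")
    case True
    \<comment> \<open>The successor has index \<open>Suc j\<close>. As \<open>2 \<le> Suc j\<close>,
      its first removal is modulo \<open>a (Suc j)\<close>, that is, modulo itself, and leaves
      0.\<close>
    have "n + 1 < a (Suc (Suc j))" using True mono by (simp add: strict_mono_less)
    then have volatile: "two_volatile a n" using True j by (simp add: two_volatile_iff)
    have top: "n = a (index a n + 1) - 1 \<and> index a n \<ge> 1"
      using True j by (simp flip: j_def)
    show ?thesis
      unfolding if_not_P[OF False] if_P[OF top]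
      using volatile by (simp add: representation_word_def)
  next
    case neq: False
    have succ: "n + 1 < a (Suc j)" using bounds neq by simp
    have diff: "n - a j + 1 = n + 1 - a j" using bounds by simp
    \<comment> \<open>For \<open>j = 1\<close> no multiple of \<open>a j\<close> is removed, so
      \<open>greedy_rem_diff\<close> does not apply; both remainders are then positive
      successors.\<close>
    have "greedy_rem a 2 j (n + 1) = 0 \<longleftrightarrow> greedy_rem a 2 j (n - a j + 1) = 0"
    proof (cases "j = 1")
      case True
      then show ?thesis by (simp add: greedy_rem_less)
    next
      case False
      then show ?thesis using greedy_rem_diff[of a j "n + 1" 2] bounds j diff by simp
    qed
    then have "two_volatile a n \<longleftrightarrow> two_volatile a (n - a j)"
      using succ by (simp add: two_volatile_iff[of _ j] del: greedy_rem.simps)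
    moreover have "last (representation a n) = last (representation a (n - a j))"
      using bounds j greedy_rem_diff[of a j n 1] by (simp add: last_representation[of _ j])
    ultimately show ?thesis
      using False neq n bounds by (auto simp: representation_word_def simp flip: j_def)
  qed
qed

end

theorem theorem4p3:
  fixes a :: "nat \<Rightarrow> nat" and w :: "nat word"
  assumes "representing_sequence a"
  shows "w = representation_word a \<longleftrightarrow>
    is_infinite w \<and>
    (\<forall>n. letter w n =
      (if n < a 1 then n
       else if n = a (index a n + 1) - 1 \<and> index a n \<ge> 1 then a 1
       else letter w (n - a (index a n))))"
proof
  assume w: "w = representation_word a"
  show "is_infinite w \<and>
    (\<forall>n. letter w n =
      (if n < a 1 then n
       else if n = a (index a n + 1) - 1 \<and> index a n \<ge> 1 then a 1
       else letter w (n - a (index a n))))"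
    unfolding w
    by (intro conjI allI letter_representation_word[OF assms]) (simp add: representation_word_def)
next
  assume w: "is_infinite w \<and>
    (\<forall>n. letter w n =
      (if n < a 1 then n
       else if n = a (index a n + 1) - 1 \<and> index a n \<ge> 1 then a 1
       else letter w (n - a (index a n))))"
  have "letter w n = letter (representation_word a) n" for n
  proof (induction n rule: less_induct)
    case (less n)
    \<comment> \<open>The restriction keeps out \<open>n = 0\<close>, where the recursive argument
      would not be smaller; \<open>if_cong\<close> supplies it in the last branch.\<close>
    have eq: "letter w (n - a (index a n)) = letter (representation_word a) (n - a (index a n))"
      if "\<not> n < a 1"
      using that a_pos[OF assms, of 1] a_pos[OF assms, of "index a n"] by (intro less) linarith
    show ?case
      by (rule trans[OF w[THEN conjunct2, rule_format]
            trans[OF _ letter_representation_word[OF assms, symmetric]]])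
        (intro if_cong refl eq)
  qed
  \<comment> \<open>Equal letters identify the words only once \<open>w\<close> is known to be
    infinite, since \<open>letter\<close> is total on finite words too.\<close>
  moreover obtain f where "w = InfWord f" using w by (cases w) auto
  ultimately show "w = representation_word a" by (auto simp: representation_word_def)
qed

end
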